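(* Let $\kappa$ be a regular, uncountable cardinal and let $\alpha<\kappa^+$ be an ordinal. Then there is a first countable, scattered $T_2$ space $Y$ such that $\operatorname{ord}_\ell(Y)=\kappa\cdot\alpha$.
   Context: A well-ordering $\prec$ of (the underlying set of) a topological space $X$ is left-separating if $\{x\in X: x\prec y\}$ is closed in $X$ for every $y\in X$. A space is left-separated if it has a left-separating well-ordering. For a left-separated space $X$, its left-separating type $\operatorname{ord}_\ell(X)$ is the minimum of the order types of the left-separating well-orderings of $X$; write $\operatorname{ord}_\ell(X)=\infty$ if $X$ is not left-separated. A space is scattered if each of its non-empty subspaces has an isolated point. The product $\kappa\cdot\alpha$ is ordinal multiplication. *)

theory Defs
  imports "HOL-Analysis.Analysis"
begin

unbundle cardinal_syntax
no_notation elt_set_eq (infix \<open>=o\<close> 50)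

text \<open>
  Ordinals are represented, as in the HOL cardinal library, by well-orders
  (reflexive relations \<open>r\<close> with \<open>Well_order r\<close>, living on
  \<open>Field r\<close>) up to order isomorphism \<open>=o\<close>, and compared by
  \<open>\<le>o\<close> and \<open><o\<close>. Spaces are elements of the type
  \<^typ>\<open>'a topology\<close>, with underlying set \<open>topspace X\<close>.
\<close>

definition left_separating :: "'a topology \<Rightarrow> 'a rel \<Rightarrow> bool" where
  "left_separating X r \<longleftrightarrow>
     well_order_on (topspace X) r \<and>
     (\<forall>y\<in>topspace X. closedin X {x \<in> topspace X. (x, y) \<in> r \<and> x \<noteq> y})"

definition left_separated :: "'a topology \<Rightarrow> bool" where
  "left_separated X \<longleftrightarrow> (\<exists>r. left_separating X r)"

text \<open>
  The left-separating type; \<open>None\<close> plays the role of \<open>\<infinity>\<close>. The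
  choice only fixes a representative: a left-separating well-order of minimal order type
  exists and is unique up to \<open>=o\<close>, by the two lemmas that follow.
\<close>

definition ord_left :: "'a topology \<Rightarrow> 'a rel option" where
  "ord_left X =
     (if left_separated X
      then Some (SOME r. left_separating X r \<and>
                         (\<forall>r'. left_separating X r' \<longrightarrow> r \<le>o r'))
      else None)"

lemma ord_left_SomeD:
  assumes "ord_left X = Some r"
  shows "left_separating X r" and "\<And>r'. left_separating X r' \<Longrightarrow> r \<le>o r'"
proof -
  let ?R = "{r. left_separating X r}"
  have sep: "left_separated X"
    and r: "r = (SOME r. left_separating X r \<and> (\<forall>r'. left_separating X r' \<longrightarrow> r \<le>o r'))"
    using assms by (auto simp: ord_left_def split: if_splits)
  have "?R \<noteq> {}" using sep by (auto simp: left_separated_def)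
  moreover have "\<forall>r\<in>?R. Well_order r"
    by (auto simp: left_separating_def dest: well_order_on_Well_order)
  ultimately have "\<exists>r\<in>?R. \<forall>r'\<in>?R. r \<le>o r'" by (rule exists_minim_Well_order)
  then have "\<exists>r. left_separating X r \<and> (\<forall>r'. left_separating X r' \<longrightarrow> r \<le>o r')" by blast
  from someI_ex[OF this]
  show "left_separating X r" and "\<And>r'. left_separating X r' \<Longrightarrow> r \<le>o r'"
    unfolding r by blast+
qed

lemma ord_left_iso_iff:
  assumes "ord_left X = Some r"
  shows "s =o r \<longleftrightarrow>
     (\<exists>r'. left_separating X r' \<and> s =o r') \<and> (\<forall>r'. left_separating X r' \<longrightarrow> s \<le>o r')"
  using ord_left_SomeD[OF assms]
  by (meson ordIso_iff_ordLeq ordIso_ordLeq_trans ordIso_symmetric ordLeq_ordIso_trans)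

definition scattered_space :: "'a topology \<Rightarrow> bool" where
  "scattered_space X \<longleftrightarrow>
     (\<forall>S. S \<subseteq> topspace X \<and> S \<noteq> {} \<longrightarrow> (\<exists>x\<in>S. openin (subtopology X S) {x}))"

text \<open>
  The ordinal product \<open>r \<cdot> s\<close>, i.e. \<open>s\<close> many copies of \<open>r\<close> put one
  after the other: lexicographic order in which the second component is the more significant.
\<close>

definition ordinal_prod :: "'a rel \<Rightarrow> 'b rel \<Rightarrow> ('a \<times> 'b) rel"  (infixl \<open>\<cdot>o\<close> 80) where
  "r \<cdot>o s =
     {((x, u), (y, v)). x \<in> Field r \<and> y \<in> Field r \<and> (u, v) \<in> s \<and> (u = v \<longrightarrow> (x, y) \<in> r)}"

end

theory Submission
  imports Defs
begin

text \<open>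
  For \<open>\<alpha> = 0\<close> take the empty space, and let \<open>\<alpha> > 0\<close> from now on. The points of \<open>Y\<close> are the \<open>d
  < \<kappa>\<close> of cofinality \<open>\<omega>\<close>, and each of them gets a level \<open>l d < \<alpha>\<close>. A basic neighbourhood of
  \<open>d\<close> consists of \<open>d\<close> and of all points of higher level in an interval \<open>(b, d)\<close>. Such
  neighbourhoods are open, because levels only go up inside them. As \<open>d\<close> has cofinality \<open>\<omega>\<close>,
  countably many \<open>b\<close> suffice; as \<open>d\<close> is the largest element of its neighbourhoods, the space
  is Hausdorff and scattered.

  Upper bound. Order the points by level, and within a level as in \<open>\<kappa>\<close>. A neighbourhood of \<open>d\<close>
  then has \<open>d\<close> as its least element, so this order is left-separating, and \<open>d \<mapsto> (d, l d)\<close>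
  embeds it into \<open>\<kappa> \<cdot> \<alpha>\<close>.

  Lower bound. Suppose a left-separating order is shorter than \<open>\<kappa> \<cdot> \<alpha>\<close>, and place each point
  at its position \<open>(a, b)\<close>, the position \<open>a < \<kappa>\<close> in the block \<open>b < \<alpha>\<close>. It is shown by
  induction on \<open>u < \<alpha>\<close> that only boundedly many points of level at least \<open>u\<close> lie in a block
  before \<open>u\<close> (\<open>few_early\<close>). Assume that the set \<open>S\<close> of these points is unbounded. Choosing
  above each \<open>d < \<kappa>\<close> a point of \<open>S\<close> and taking its block gives a function with values below
  \<open>u\<close> that, by the induction hypothesis, is eventually at least \<open>v\<close> for each \<open>v < u\<close>. Levels are arranged
  so that whenever such a function exists, there is also one, \<open>h\<close>, with \<open>l d = h d\<close> for a
  stationary set of \<open>d\<close>. Almost all of these \<open>d\<close> are limits of points of \<open>S\<close>, which have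
  higher level, so in the left-separating order \<open>d\<close> precedes some \<open>s \<in> S\<close> that is less than
  \<open>d\<close> as an ordinal. By pressing down, one \<open>s\<close> works for stationarily many \<open>d\<close>. Fewer than \<open>\<kappa>\<close>
  of them fit into the part of block \<open>b s\<close> before \<open>s\<close>, hence unboundedly many lie in a block
  before \<open>b s < u\<close>, although their levels \<open>h d\<close> are eventually at least \<open>b s\<close>. This
  contradicts the induction hypothesis for \<open>b s\<close>.

  The bound on the order type gives a last block \<open>u\<close> of which only a part of size less than
  \<open>\<kappa>\<close> is occupied, and there is no room for the \<open>\<kappa>\<close> points of level \<open>u\<close>.

  The level function needs up to \<open>\<kappa>\<close> disjoint stationary sets of points of cofinality \<open>\<omega>\<close>, which
  come from pressing down on a fixed rung of ladders (\<open>stationary_partition\<close>).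
\<close>

section \<open>Strict parts of well-orders\<close>

definition prec :: "'c \<Rightarrow> 'c rel \<Rightarrow> 'c \<Rightarrow> bool"  ("(_ \<prec>\<^bsub>_\<^esub> _)" [51, 0, 51] 50) where
  "x \<prec>\<^bsub>r\<^esub> y \<longleftrightarrow> (x, y) \<in> r \<and> x \<noteq> y"

lemma prec_Field: "x \<prec>\<^bsub>r\<^esub> y \<Longrightarrow> x \<in> Field r \<and> y \<in> Field r"
  by (auto simp: prec_def Field_def)

lemma prec_trans:
  assumes "Well_order r" "x \<prec>\<^bsub>r\<^esub> y" "y \<prec>\<^bsub>r\<^esub> z"
  shows "x \<prec>\<^bsub>r\<^esub> z"
  using assms unfolding prec_def order_on_defs trans_def antisym_def by blast

lemma prec_asym: "Well_order r \<Longrightarrow> x \<prec>\<^bsub>r\<^esub> y \<Longrightarrow> \<not> y \<prec>\<^bsub>r\<^esub> x"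
  unfolding prec_def order_on_defs antisym_def by blast

lemma prec_linear:
  "Well_order r \<Longrightarrow> x \<in> Field r \<Longrightarrow> y \<in> Field r \<Longrightarrow> x \<prec>\<^bsub>r\<^esub> y \<or> x = y \<or> y \<prec>\<^bsub>r\<^esub> x"
  unfolding prec_def order_on_defs total_on_def by blast

lemma le_iff_prec:
  "Well_order r \<Longrightarrow> (x, y) \<in> r \<longleftrightarrow> x \<prec>\<^bsub>r\<^esub> y \<or> x = y \<and> x \<in> Field r"
  unfolding prec_def order_on_defs refl_on_def by (auto simp: Field_def)

lemma cofinal_iff: "cofinal S r \<longleftrightarrow> (\<forall>x\<in>Field r. \<exists>s\<in>S. x \<prec>\<^bsub>r\<^esub> s)"
  unfolding cofinal_def prec_def by blast

lemma cofinal_mono: "cofinal A r \<Longrightarrow> A \<subseteq> B \<Longrightarrow> cofinal B r"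
  unfolding cofinal_def by blast

lemma cofinal_UnD:
  assumes r: "Well_order r" and "cofinal (A \<union> B) r"
  shows "cofinal A r \<or> cofinal B r"
proof (rule ccontr)
  assume "\<not> ?thesis"
  then obtain a b where a: "a \<in> Field r" "\<And>s. s \<in> A \<Longrightarrow> \<not> a \<prec>\<^bsub>r\<^esub> s"
    and b: "b \<in> Field r" "\<And>s. s \<in> B \<Longrightarrow> \<not> b \<prec>\<^bsub>r\<^esub> s"
    unfolding cofinal_iff by blast
  obtain sa sb where "sa \<in> A \<union> B" "a \<prec>\<^bsub>r\<^esub> sa" "sb \<in> A \<union> B" "b \<prec>\<^bsub>r\<^esub> sb"
    using assms(2) a b unfolding cofinal_iff by blast
  then show False using prec_linear[OF r a(1) b(1)] a(2) b(2) prec_trans[OF r] by blast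
qed

lemma prec_wf: "Well_order r \<Longrightarrow> wf {(x, y). x \<prec>\<^bsub>r\<^esub> y}"
  by (rule wf_subset[of "r - Id"]) (auto simp: well_order_on_def prec_def)

lemma prec_least:
  assumes "Well_order r" "x \<in> S" "S \<subseteq> Field r"
  obtains m where "m \<in> S" "\<And>y. y \<in> S \<Longrightarrow> y = m \<or> m \<prec>\<^bsub>r\<^esub> y"
proof -
  obtain m where "m \<in> S" "\<And>y. y \<prec>\<^bsub>r\<^esub> m \<Longrightarrow> y \<notin> S"
    using wfE_min[OF prec_wf[OF assms(1)] assms(2)] by (metis case_prodI mem_Collect_eq)
  then show ?thesis
    using that prec_linear[OF assms(1)] assms(3) by (metis subset_iff)
qed

text \<open>
  Otherwise following \<open>f\<close> by an isomorphism of \<open>s\<close> onto a proper initial segment of \<open>r\<close> gives a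
  strictly monotone self-map of \<open>r\<close>, which moves no element down, although its values
  stay below some \<open>a\<close>.
\<close>
lemma strictly_monotone_imp_ordLeq:
  assumes r: "Well_order r" and s: "Well_order s"
    and f: "\<And>x y. x \<prec>\<^bsub>r\<^esub> y \<Longrightarrow> f x \<prec>\<^bsub>s\<^esub> f y" "\<And>x. x \<in> Field r \<Longrightarrow> f x \<in> Field s"
  shows "r \<le>o s"
proof (rule ccontr)
  assume "\<not> r \<le>o s"
  then have "s <o r" using r s not_ordLeq_iff_ordLess by blast
  then obtain a h where a: "a \<in> Field r" and h: "iso s (Restr r (underS r a)) h"
    using ordLess_iff_ordIso_Restr[OF r s] unfolding ordIso_def by auto
  have h1: "h x \<prec>\<^bsub>r\<^esub> h y" if "x \<prec>\<^bsub>s\<^esub> y" for x y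
    using that iso_forward[OF _ h, of x y] iso_imp_inj_on[OF h] prec_Field[OF that]
    by (auto simp: prec_def dest: inj_onD)
  have h2: "h x \<prec>\<^bsub>r\<^esub> a" if "x \<in> Field s" for x
  proof -
    have "h x \<in> Field (Restr r (underS r a))" using iso_Field[OF h] that by blast
    then show ?thesis by (auto simp: Field_def underS_def prec_def)
  qed
  have "\<not> h (f x) \<prec>\<^bsub>r\<^esub> x" for x
  proof (induction x rule: wf_induct_rule[OF prec_wf[OF r]])
    case (1 x)
    then show ?case using f(1) h1 by blast
  qed
  then show False using h2 f(2) a by blast
qed

section \<open>Stationary sets\<close>

locale uncountable_regular_cardinal =
  fixes \<kappa> :: "'a rel"
  assumes card: "Card_order \<kappa>" and uncountable: "natLeq <o \<kappa>" and regular: "regularCard \<kappa>"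
begin

abbreviation less :: "'a \<Rightarrow> 'a \<Rightarrow> bool"  (infix "\<sqsubset>" 50) where
  "x \<sqsubset> y \<equiv> x \<prec>\<^bsub>\<kappa>\<^esub> y"

lemma wo: "Well_order \<kappa>"
  using card by (simp add: card_order_on_well_order_on)

lemmas less_trans = prec_trans[OF wo]
lemmas less_asym = prec_asym[OF wo]
lemmas less_linear = prec_linear[OF wo]

lemma infinite_Field: "infinite (Field \<kappa>)"
proof -
  have "natLeq \<le>o \<kappa>" using uncountable ordLess_imp_ordLeq by blast
  then have "|UNIV :: nat set| \<le>o |Field \<kappa>|"
    using card_of_mono2 Field_natLeq by metis
  then show ?thesis using card_of_ordLeq_infinite by blast
qed

lemma ex_greater: "x \<in> Field \<kappa> \<Longrightarrow> \<exists>y. x \<sqsubset> y"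
  using infinite_Card_order_limit[OF card infinite_Field] unfolding prec_def by blast

lemma small_segment: "|under \<kappa> x| <o \<kappa>"
proof (cases "x \<in> Field \<kappa>")
  case True
  then obtain y where y: "x \<sqsubset> y" using ex_greater by blast
  have "under \<kappa> x \<subseteq> underS \<kappa> y"
    using y wo unfolding prec_def under_def underS_def order_on_defs trans_def antisym_def by blast
  then show ?thesis
    using card_of_underS[OF card] y prec_Field[OF y] card_of_mono1 ordLeq_ordLess_trans by metis
next
  case False
  then have "under \<kappa> x = {}" by (auto simp: under_def Field_def)
  moreover obtain y where "y \<in> Field \<kappa>" using infinite_Field by fastforce
  ultimately show ?thesis
    using card_of_underS[OF card] card_of_empty ordLeq_ordLess_trans by metis
qed

lemma small_countable: "|UNIV :: nat set| <o \<kappa>"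
  using card_of_nat uncountable ordIso_ordLess_trans by blast

lemma small_not_cofinal: "|X| <o \<kappa> \<Longrightarrow> X \<subseteq> Field \<kappa> \<Longrightarrow> \<not> cofinal X \<kappa>"
  using regular not_ordLess_ordIso unfolding regularCard_def by blast

lemma not_cofinal_bounded:
  assumes "X \<subseteq> Field \<kappa>" "\<not> cofinal X \<kappa>"
  shows "\<exists>b\<in>Field \<kappa>. \<forall>x\<in>X. x \<sqsubset> b"
proof -
  obtain a where a: "a \<in> Field \<kappa>" "\<forall>x\<in>X. \<not> a \<sqsubset> x"
    using assms unfolding cofinal_iff by blast
  obtain b where "a \<sqsubset> b" using ex_greater a by blast
  then show ?thesis using a assms less_linear less_trans prec_Field by (metis subset_iff)
qed

lemma small_bounded:
  "X \<subseteq> Field \<kappa> \<Longrightarrow> |X| <o \<kappa> \<Longrightarrow> \<exists>b\<in>Field \<kappa>. \<forall>x\<in>X. x \<sqsubset> b"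
  using small_not_cofinal not_cofinal_bounded by blast

text \<open>
  If \<open>I\<close> is monotone, the closure points of \<open>G\<close> are closure points of all the \<open>g i\<close> with \<open>i \<in> I y\<close>
  for some smaller \<open>y\<close>. With \<open>I y = UNIV\<close> countable this intersects countably many clubs, and with
  \<open>I y = under \<kappa> y\<close> it forms a diagonal intersection.
\<close>
lemma simultaneous_bound:
  fixes g :: "'i \<Rightarrow> 'a \<Rightarrow> 'a"
  assumes g: "\<And>i. g i \<in> Field \<kappa> \<rightarrow> Field \<kappa>" and I: "\<And>y. |I y| <o \<kappa>"
  shows "\<exists>G\<in>Field \<kappa> \<rightarrow> Field \<kappa>. \<forall>y. \<forall>i\<in>I y. \<forall>z\<in>under \<kappa> y. g i z \<sqsubset> G y"
proof -
  have "\<exists>b\<in>Field \<kappa>. \<forall>i\<in>I y. \<forall>z\<in>under \<kappa> y. g i z \<sqsubset> b" for y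
  proof -
    let ?X = "\<Union>i\<in>I y. g i ` under \<kappa> y"
    have "under \<kappa> y \<subseteq> Field \<kappa>" by (auto simp: under_def Field_def)
    then have "?X \<subseteq> Field \<kappa>" using g by blast
    moreover have "|g i ` under \<kappa> y| <o \<kappa>" for i
      using small_segment card_of_image ordLeq_ordLess_trans by blast
    then have "|?X| <o \<kappa>"
      by (intro card_of_UNION_ordLess_infinite_Field_regularCard[OF regular _ I])
        (simp_all add: cinfinite_def card infinite_Field)
    ultimately show ?thesis using small_bounded[of ?X] by blast
  qed
  then obtain G where "\<forall>y. G y \<in> Field \<kappa> \<and> (\<forall>i\<in>I y. \<forall>z\<in>under \<kappa> y. g i z \<sqsubset> G y)"
    by metis
  then show ?thesis by (intro bexI[of _ G]) auto
qed

text \<open>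
  As \<open>\<kappa>\<close> is regular and uncountable, the sets of nonzero closure points of functions form a base of
  the club filter, so this is the usual notion. The least element of \<open>\<kappa>\<close>, vacuously closed under
  everything, has to be excluded.
\<close>
definition stationary :: "'a set \<Rightarrow> bool" where
  "stationary A \<longleftrightarrow>
     (\<forall>g\<in>Field \<kappa> \<rightarrow> Field \<kappa>. \<exists>d\<in>A. (\<exists>x. x \<sqsubset> d) \<and> (\<forall>x. x \<sqsubset> d \<longrightarrow> g x \<sqsubset> d))"

lemma stationaryE:
  assumes "stationary A" "g \<in> Field \<kappa> \<rightarrow> Field \<kappa>"
  obtains d x where "d \<in> A" "x \<sqsubset> d" "\<And>y. y \<sqsubset> d \<Longrightarrow> g y \<sqsubset> d"
  using assms unfolding stationary_def by blast

lemma stationary_mono: "stationary A \<Longrightarrow> A \<subseteq> B \<Longrightarrow> stationary B"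
  unfolding stationary_def by blast

lemma stationary_cofinal:
  assumes "stationary A" shows "cofinal A \<kappa>"
  unfolding cofinal_iff
proof
  fix a assume "a \<in> Field \<kappa>"
  then obtain d x where "d \<in> A" "x \<sqsubset> d" "\<And>y. y \<sqsubset> d \<Longrightarrow> a \<sqsubset> d"
    using stationaryE[OF assms, of "\<lambda>_. a"] by (metis Pi_I)
  then show "\<exists>s\<in>A. a \<sqsubset> s" by blast
qed

lemma under_of_less: "x \<sqsubset> d \<Longrightarrow> x \<in> under \<kappa> x"
  using le_iff_prec[OF wo, of x x] prec_Field[of x] unfolding under_def by blast

lemma stationary_closed_points:
  assumes A: "stationary A" and h: "h \<in> Field \<kappa> \<rightarrow> Field \<kappa>"
  shows "stationary {d \<in> A. \<forall>x. x \<sqsubset> d \<longrightarrow> h x \<sqsubset> d}"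
  unfolding stationary_def
proof
  fix g assume g: "g \<in> Field \<kappa> \<rightarrow> Field \<kappa>"
  let ?g = "\<lambda>i::nat. if i = 0 then g else h"
  have "\<And>i. ?g i \<in> Field \<kappa> \<rightarrow> Field \<kappa>" using g h by simp
  then obtain G where G: "G \<in> Field \<kappa> \<rightarrow> Field \<kappa>"
    "\<forall>y. \<forall>i\<in>UNIV. \<forall>z\<in>under \<kappa> y. ?g i z \<sqsubset> G y"
    using simultaneous_bound[of ?g "\<lambda>_. UNIV"] small_countable by blast
  obtain d x where d: "d \<in> A" "x \<sqsubset> d" "\<And>y. y \<sqsubset> d \<Longrightarrow> G y \<sqsubset> d"
    using stationaryE[OF A G(1)] by metis
  have "?g i y \<sqsubset> d" if "y \<sqsubset> d" for i y
    using G(2) d(3)[OF that] under_of_less[OF that] less_trans by blast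
  from this[of _ 0] this[of _ 1]
  show "\<exists>d\<in>{d \<in> A. \<forall>x. x \<sqsubset> d \<longrightarrow> h x \<sqsubset> d}. (\<exists>x. x \<sqsubset> d) \<and> (\<forall>x. x \<sqsubset> d \<longrightarrow> g x \<sqsubset> d)"
    using d by auto
qed

text \<open>
  Fodor's lemma. If \<open>g v\<close> witnesses that the fibre of \<open>v\<close> is not stationary, a point of \<open>A\<close> closed
  under the diagonal bound of all the \<open>g v\<close> is closed under the one belonging to its own value.
\<close>
lemma pressing_down:
  assumes A: "stationary A" and f: "\<And>d. d \<in> A \<Longrightarrow> f d \<sqsubset> d"
  shows "\<exists>v\<in>f ` A. stationary {d \<in> A. f d = v}"
proof (rule ccontr)
  assume "\<not> ?thesis"
  then have "\<forall>v\<in>f ` A. \<exists>g\<in>Field \<kappa> \<rightarrow> Field \<kappa>.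
      \<forall>d\<in>A. f d = v \<longrightarrow> (\<exists>x. x \<sqsubset> d) \<longrightarrow> (\<exists>x. x \<sqsubset> d \<and> \<not> g x \<sqsubset> d)"
    unfolding stationary_def by fastforce
  then obtain g where g: "\<And>v. v \<in> f ` A \<Longrightarrow> g v \<in> Field \<kappa> \<rightarrow> Field \<kappa>"
    "\<And>d. d \<in> A \<Longrightarrow> \<exists>x. x \<sqsubset> d \<Longrightarrow> \<exists>x. x \<sqsubset> d \<and> \<not> g (f d) x \<sqsubset> d"
    by (metis image_eqI)
  let ?g = "\<lambda>v. if v \<in> f ` A then g v else id"
  have "\<And>v. ?g v \<in> Field \<kappa> \<rightarrow> Field \<kappa>" using g(1) by simp
  then obtain G where G: "G \<in> Field \<kappa> \<rightarrow> Field \<kappa>"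
    "\<forall>y. \<forall>v\<in>under \<kappa> y. \<forall>z\<in>under \<kappa> y. ?g v z \<sqsubset> G y"
    using simultaneous_bound[of ?g "under \<kappa>"] small_segment by blast
  obtain d where d: "d \<in> A" "\<And>y. y \<sqsubset> d \<Longrightarrow> G y \<sqsubset> d"
    using stationaryE[OF A G(1)] by metis
  have fd: "f d \<sqsubset> d" using f d by blast
  then obtain x where x: "x \<sqsubset> d" "\<not> g (f d) x \<sqsubset> d" using g(2)[OF d(1)] by blast
  have "x \<sqsubset> f d \<or> x = f d \<or> f d \<sqsubset> x"
    using less_linear prec_Field[OF fd] prec_Field[OF x(1)] by blast
  then obtain y where y: "y \<sqsubset> d" "f d \<in> under \<kappa> y" "x \<in> under \<kappa> y"
  proof (elim disjE)
    assume "f d \<sqsubset> x"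
    then show ?thesis using that[of x] x(1) under_of_less[OF x(1)] by (simp add: under_def prec_def)
  qed (use that[of "f d"] fd under_of_less[OF fd] in \<open>auto simp: under_def prec_def\<close>)
  then have "?g (f d) x \<sqsubset> G y" using G(2) by blast
  then show False using d x y less_trans[of _ "G y" d] by auto
qed

text \<open>
  Almost every \<open>d \<in> D\<close> is a limit of \<open>S\<close>, so it is related to some \<open>s \<in> S\<close> below it, and \<open>s\<close> can
  be pressed down.
\<close>

lemma pressing_down_to_cofinal_set:
  assumes D: "stationary D" and S: "cofinal S \<kappa>"
    and R: "\<And>d. d \<in> D \<Longrightarrow> \<exists>b. b \<sqsubset> d \<and> (\<forall>s\<in>S. b \<sqsubset> s \<longrightarrow> s \<sqsubset> d \<longrightarrow> R d s)"
  shows "\<exists>s\<in>S. stationary {d \<in> D. R d s}"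
proof -
  have "\<forall>x. \<exists>s. x \<in> Field \<kappa> \<longrightarrow> s \<in> S \<and> x \<sqsubset> s" using S unfolding cofinal_iff by blast
  then obtain h where h: "\<And>x. x \<in> Field \<kappa> \<Longrightarrow> h x \<in> S \<and> x \<sqsubset> h x" by metis
  then have hF: "h \<in> Field \<kappa> \<rightarrow> Field \<kappa>" by (auto dest: prec_Field)
  \<comment> \<open>Points closed under \<open>h\<close> are limits of \<open>S\<close>.\<close>
  let ?C = "{d \<in> D. \<forall>x. x \<sqsubset> d \<longrightarrow> h x \<sqsubset> d}"
  have C: "stationary ?C" using stationary_closed_points[OF D hF] .
  have "\<exists>s\<in>S. s \<sqsubset> d \<and> R d s" if "d \<in> ?C" for d
  proof -
    obtain b where b: "b \<sqsubset> d" "\<forall>s\<in>S. b \<sqsubset> s \<longrightarrow> s \<sqsubset> d \<longrightarrow> R d s"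
      using R \<open>d \<in> ?C\<close> by blast
    have "h b \<in> S" "b \<sqsubset> h b" using h prec_Field[OF b(1)] by blast+
    moreover have "h b \<sqsubset> d" using that b(1) by blast
    ultimately show ?thesis using b(2) by blast
  qed
  then have "\<forall>d\<in>?C. \<exists>s. s \<in> S \<and> s \<sqsubset> d \<and> R d s" by blast
  from bchoice[OF this]
  obtain t where t: "\<And>d. d \<in> ?C \<Longrightarrow> t d \<in> S \<and> t d \<sqsubset> d \<and> R d (t d)" by blast
  then obtain v where v: "v \<in> t ` ?C" "stationary {d \<in> ?C. t d = v}"
    using pressing_down[OF C, of t] by blast
  have "{d \<in> ?C. t d = v} \<subseteq> {d \<in> D. R d v}" using t by blast
  then show ?thesis using v stationary_mono t by blast
qed

section \<open>Splitting the points of countable cofinality into stationary sets\<close>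

definition ladder :: "'a \<Rightarrow> (nat \<Rightarrow> 'a) \<Rightarrow> bool" where
  "ladder d c \<longleftrightarrow> (\<forall>n. c n \<sqsubset> d) \<and> (\<forall>x. x \<sqsubset> d \<longrightarrow> (\<exists>n. x \<sqsubset> c n))"

definition omega_limits :: "'a set" where
  "omega_limits = {d. \<exists>c. ladder d c}"

lemma omega_limits_Field: "omega_limits \<subseteq> Field \<kappa>"
  unfolding omega_limits_def ladder_def by (auto dest: prec_Field)

text \<open>
  The supremum of \<open>a\<close>, \<open>G a\<close>, \<open>G (G a)\<close>, \<open>\<dots>\<close> exists because \<open>\<kappa>\<close> is regular and uncountable,
  and it is closed under \<open>g\<close> when \<open>G\<close> bounds \<open>g\<close> on initial segments.
\<close>
lemma stationary_omega_limits: "stationary omega_limits"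
  unfolding stationary_def
proof
  fix g assume g: "g \<in> Field \<kappa> \<rightarrow> Field \<kappa>"
  \<comment> \<open>The identity among the functions to be bounded makes \<open>G\<close> increasing along its orbits.\<close>
  let ?g = "\<lambda>i::nat. if i = 0 then g else id"
  have "\<And>i. ?g i \<in> Field \<kappa> \<rightarrow> Field \<kappa>" using g by simp
  then obtain G where G: "G \<in> Field \<kappa> \<rightarrow> Field \<kappa>"
    "\<forall>y. \<forall>i\<in>UNIV. \<forall>z\<in>under \<kappa> y. ?g i z \<sqsubset> G y"
    using simultaneous_bound[of ?g "\<lambda>_. UNIV"] small_countable by blast
  obtain a where a: "a \<in> Field \<kappa>" using infinite_Field by fastforce
  define c where "c n = (G ^^ n) a" for n
  have cF: "c n \<in> Field \<kappa>" for n
    by (induction n) (use a G in \<open>auto simp: c_def\<close>)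
  have cS: "?g i z \<sqsubset> c (Suc n)" if "z \<in> under \<kappa> (c n)" for i n z
    using G that by (simp add: c_def)
  have self: "c n \<in> under \<kappa> (c n)" for n
    using cF ex_greater under_of_less by blast
  have cinc: "c n \<sqsubset> c (Suc n)" for n using cS[OF self, of 1 n] by simp
  let ?B = "{b \<in> Field \<kappa>. \<forall>n. c n \<sqsubset> b}"
  have "|range c| <o \<kappa>" using small_countable card_of_image ordLeq_ordLess_trans by blast
  then obtain b where b: "b \<in> ?B" using small_bounded[of "range c"] cF by blast
  obtain d where d: "d \<in> ?B" "\<And>y. y \<in> ?B \<Longrightarrow> y = d \<or> d \<sqsubset> y"
    using prec_least[OF wo b] by (metis (no_types, lifting) mem_Collect_eq subsetI)
  have cof: "\<exists>n. x \<sqsubset> c n" if x: "x \<sqsubset> d" for x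
  proof -
    have "x \<notin> ?B" using d(2) x less_asym by blast
    then obtain n where "\<not> c n \<sqsubset> x" using prec_Field[OF x] by blast
    then show ?thesis using less_linear cF prec_Field[OF x] cinc less_trans by metis
  qed
  have "ladder d c" using d(1) cof unfolding ladder_def by blast
  moreover have "g x \<sqsubset> d" if x: "x \<sqsubset> d" for x
  proof -
    obtain n where "x \<sqsubset> c n" using cof[OF x] by blast
    then have "g x \<sqsubset> c (Suc n)" using cS[of x n 0] by (simp add: under_def prec_def)
    then show ?thesis using d(1) less_trans by blast
  qed
  moreover have "c 0 \<sqsubset> d" using d by blast
  ultimately show "\<exists>d\<in>omega_limits. (\<exists>x. x \<sqsubset> d) \<and> (\<forall>x. x \<sqsubset> d \<longrightarrow> g x \<sqsubset> d)"
    unfolding omega_limits_def by blast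
qed

text \<open>
  If every \<open>n\<close> had a bound \<open>b n\<close> such that almost all \<open>d\<close> have their \<open>n\<close>-th rung below \<open>b n\<close>,
  then almost all \<open>d\<close> would have their whole ladder below \<open>sup b\<close>.
\<close>
lemma stationary_high_rungs:
  assumes c: "\<And>d. d \<in> omega_limits \<Longrightarrow> ladder d (c d)"
  shows "\<exists>n. \<forall>b\<in>Field \<kappa>. stationary {d \<in> omega_limits. \<not> c d n \<sqsubset> b}"
proof (rule ccontr)
  assume "\<not> ?thesis"
  then have "\<forall>n. \<exists>b\<in>Field \<kappa>. \<exists>g\<in>Field \<kappa> \<rightarrow> Field \<kappa>. \<forall>d\<in>omega_limits. \<not> c d n \<sqsubset> b \<longrightarrow>
      (\<exists>x. x \<sqsubset> d) \<longrightarrow> (\<exists>x. x \<sqsubset> d \<and> \<not> g x \<sqsubset> d)"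
    unfolding stationary_def by simp blast
  then obtain b g where b: "\<And>n. b n \<in> Field \<kappa>" and g: "\<And>n. g n \<in> Field \<kappa> \<rightarrow> Field \<kappa>"
    and *: "\<And>n d. d \<in> omega_limits \<Longrightarrow> \<not> c d n \<sqsubset> b n \<Longrightarrow>
      \<exists>x. x \<sqsubset> d \<Longrightarrow> \<exists>x. x \<sqsubset> d \<and> \<not> g n x \<sqsubset> d"
    by metis
  obtain G where G: "G \<in> Field \<kappa> \<rightarrow> Field \<kappa>"
    "\<forall>y. \<forall>i\<in>UNIV. \<forall>z\<in>under \<kappa> y. g i z \<sqsubset> G y"
    using simultaneous_bound[of g "\<lambda>_. UNIV"] g small_countable by blast
  have "|range b| <o \<kappa>" using small_countable card_of_image ordLeq_ordLess_trans by blast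
  then obtain B where B: "B \<in> Field \<kappa>" "\<And>n. b n \<sqsubset> B" using small_bounded[of "range b"] b by blast
  have "stationary {d \<in> omega_limits. \<forall>x. x \<sqsubset> d \<longrightarrow> B \<sqsubset> d}"
    using stationary_closed_points[OF stationary_omega_limits, of "\<lambda>_. B"] B by blast
  then obtain d x where d: "d \<in> omega_limits" "x \<sqsubset> d" "B \<sqsubset> d" "\<And>y. y \<sqsubset> d \<Longrightarrow> G y \<sqsubset> d"
    using stationaryE[OF _ G(1)] by (smt (verit) mem_Collect_eq)
  have "c d n \<sqsubset> b n" for n
  proof (rule ccontr)
    assume "\<not> c d n \<sqsubset> b n"
    then obtain x where x: "x \<sqsubset> d" "\<not> g n x \<sqsubset> d" using * d by blast
    then show False using G(2) d(4)[OF x(1)] under_of_less[OF x(1)] less_trans by blast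
  qed
  then have "c d n \<sqsubset> B" for n using B less_trans by blast
  then show False using c[OF d(1)] d(3) less_asym unfolding ladder_def by blast
qed

text \<open>
  The \<open>n\<close>-th rung is a regressive function. For the right \<open>n\<close>, pressing it down on the points with high
  \<open>n\<close>-th rung gives stationary fibres over arbitrarily large values, hence \<open>\<kappa>\<close> of them.
\<close>
lemma stationary_partition:
  fixes J :: "'j set"
  assumes J: "J \<noteq> {}" "|J| \<le>o \<kappa>"
  shows "\<exists>p. range p \<subseteq> J \<and> (\<forall>j\<in>J. stationary {d \<in> omega_limits. p d = j})"
proof -
  have "\<forall>d\<in>omega_limits. \<exists>c. ladder d c" by (simp add: omega_limits_def)
  from bchoice[OF this] obtain c where c: "\<And>d. d \<in> omega_limits \<Longrightarrow> ladder d (c d)"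
    by blast
  obtain n where n: "\<And>b. b \<in> Field \<kappa> \<Longrightarrow> stationary {d \<in> omega_limits. \<not> c d n \<sqsubset> b}"
    using stationary_high_rungs[of c] c by blast
  define V where "V = {v \<in> Field \<kappa>. stationary {d \<in> omega_limits. c d n = v}}"
  have "cofinal V \<kappa>"
    unfolding cofinal_iff
  proof
    fix a assume "a \<in> Field \<kappa>"
    then obtain b where b: "a \<sqsubset> b" using ex_greater by blast
    let ?A = "{d \<in> omega_limits. \<not> c d n \<sqsubset> b}"
    have reg: "c d n \<sqsubset> d" if "d \<in> ?A" for d using c that unfolding ladder_def by blast
    have "stationary ?A" using n prec_Field[OF b] by blast
    from pressing_down[OF this reg]
    obtain v where v: "v \<in> (\<lambda>d. c d n) ` ?A" "stationary {d \<in> ?A. c d n = v}" by blast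
    have vF: "v \<in> Field \<kappa>" using v(1) by (auto dest!: reg prec_Field)
    have "stationary {d \<in> omega_limits. c d n = v}" by (rule stationary_mono[OF v(2)]) blast
    then have "v \<in> V" unfolding V_def using vF by blast
    moreover have "a \<sqsubset> v"
    proof -
      have "\<not> v \<sqsubset> b" using v(1) by blast
      then have "v = b \<or> b \<sqsubset> v" using less_linear[OF vF, of b] prec_Field[OF b] by blast
      then show ?thesis using b less_trans[OF b] by blast
    qed
    ultimately show "\<exists>s\<in>V. a \<sqsubset> s" by blast
  qed
  moreover have "V \<subseteq> Field \<kappa>" by (auto simp: V_def)
  ultimately have V: "|V| =o \<kappa>" using regular by (simp add: regularCard_def)
  have "|J| \<le>o |V|" by (rule ordLeq_ordIso_trans[OF J(2) ordIso_symmetric[OF V]])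
  then have "\<exists>q. q ` V = J" by (rule card_of_ordLeq2[OF J(1), THEN iffD2])
  then obtain q where q: "q ` V = J" ..
  obtain j0 where j0: "j0 \<in> J" using J(1) by blast
  \<comment> \<open>Points in the other fibres may go into any part.\<close>
  define p where "p d = (if c d n \<in> V then q (c d n) else j0)" for d
  have "range p \<subseteq> J" using q j0 by (auto simp: p_def)
  moreover have "stationary {d \<in> omega_limits. p d = j}" if j: "j \<in> J" for j
  proof -
    obtain v where v: "v \<in> V" "q v = j" using q j by blast
    then have "stationary {d \<in> omega_limits. c d n = v}" unfolding V_def by blast
    then show ?thesis by (rule stationary_mono) (use v in \<open>auto simp: p_def\<close>)
  qed
  ultimately show ?thesis by blast
qed

end

section \<open>Pullbacks and ordinal products of well-orders\<close>

lemma well_order_on_pullback: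
  assumes s: "Well_order s" and f: "inj_on f A" "f ` A \<subseteq> Field s"
  shows "well_order_on A {(x, y). x \<in> A \<and> y \<in> A \<and> (f x, f y) \<in> s}" (is "well_order_on A ?r")
proof -
  have le: "refl_on (Field s) s" "trans s" "antisym s" "total_on (Field s) s" "wf (s - Id)"
    using s unfolding order_on_defs by auto
  have "wf (?r - Id)"
    by (rule wf_subset[OF wf_inv_image[OF le(5), of f]]) (auto dest: inj_onD[OF f(1)])
  moreover have "refl_on A ?r" using le(1) f(2) unfolding refl_on_def by auto
  moreover have "trans ?r" using le(2) unfolding trans_def by blast
  moreover have "antisym ?r" using le(3) f(1) unfolding antisym_def inj_on_def by blast
  moreover have "total_on A ?r"
    using le(4) f unfolding total_on_def inj_on_def by (simp add: image_subset_iff) metis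
  ultimately show ?thesis unfolding order_on_defs by auto
qed

lemma Field_ordinal_prod:
  assumes r: "Well_order r" and s: "Well_order s"
  shows "Field (r \<cdot>o s) = Field r \<times> Field s"
proof -
  have "refl_on (Field r) r" "refl_on (Field s) s" using r s unfolding order_on_defs by auto
  then show ?thesis
    unfolding refl_on_def ordinal_prod_def Field_def by fastforce
qed

lemma prec_ordinal_prod:
  assumes "Well_order r"
  shows "(x, u) \<prec>\<^bsub>r \<cdot>o s\<^esub> (y, v) \<longleftrightarrow>
    x \<in> Field r \<and> y \<in> Field r \<and> (u \<prec>\<^bsub>s\<^esub> v \<or> u = v \<and> (u, u) \<in> s \<and> x \<prec>\<^bsub>r\<^esub> y)"
  unfolding prec_def ordinal_prod_def by auto

lemma Well_order_ordinal_prod: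
  assumes r: "Well_order r" and s: "Well_order s"
  shows "Well_order (r \<cdot>o s)"
proof -
  note F = Field_ordinal_prod[OF r s]
  have R: "refl_on (Field r) r" "trans r" "antisym r" "total_on (Field r) r" "wf (r - Id)"
    and S: "refl_on (Field s) s" "trans s" "antisym s" "total_on (Field s) s" "wf (s - Id)"
    using r s unfolding order_on_defs by auto
  have "wf (r \<cdot>o s - Id)"
    by (rule wf_subset[OF wf_inv_image[OF wf_lex_prod[OF S(5) R(5)], of prod.swap]])
      (auto simp: ordinal_prod_def)
  moreover have "refl_on (Field (r \<cdot>o s)) (r \<cdot>o s)"
    unfolding F using R(1) S(1) unfolding refl_on_def ordinal_prod_def by auto
  moreover have "trans (r \<cdot>o s)"
  proof (rule transI)
    fix p q t assume "(p, q) \<in> r \<cdot>o s" "(q, t) \<in> r \<cdot>o s"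
    then show "(p, t) \<in> r \<cdot>o s"
      using R(2) S(2,3) unfolding ordinal_prod_def
      by (cases p; cases q; cases t) (auto dest: transD antisymD)
  qed
  moreover have "antisym (r \<cdot>o s)"
  proof (rule antisymI)
    fix p q assume "(p, q) \<in> r \<cdot>o s" "(q, p) \<in> r \<cdot>o s"
    then show "p = q"
      using R(3) S(3) unfolding ordinal_prod_def by (cases p; cases q) (auto dest: antisymD)
  qed
  moreover have "total_on (Field (r \<cdot>o s)) (r \<cdot>o s)"
    unfolding F total_on_def
  proof (intro ballI impI)
    fix p q assume "p \<in> Field r \<times> Field s" "q \<in> Field r \<times> Field s" "p \<noteq> q"
    then show "(p, q) \<in> r \<cdot>o s \<or> (q, p) \<in> r \<cdot>o s"
      using R(4) S(1,4) unfolding total_on_def refl_on_def ordinal_prod_def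
      by (cases p; cases q) (auto, metis+)
  qed
  moreover have "r \<cdot>o s \<subseteq> Field (r \<cdot>o s) \<times> Field (r \<cdot>o s)" by (auto simp: Field_def)
  ultimately show ?thesis unfolding order_on_defs by auto
qed

section \<open>The topology of a level function\<close>

locale level_function = uncountable_regular_cardinal \<kappa> for \<kappa> :: "'a rel" +
  fixes \<alpha> :: "'b rel" and l :: "'a \<Rightarrow> 'b"
  assumes wo_levels: "Well_order \<alpha>" and level: "l d \<in> Field \<alpha>"
begin

abbreviation lower :: "'b \<Rightarrow> 'b \<Rightarrow> bool"  (infix "\<lhd>" 50) where
  "u \<lhd> v \<equiv> u \<prec>\<^bsub>\<alpha>\<^esub> v"

definition nbhd :: "'a \<Rightarrow> 'a \<Rightarrow> 'a set" where
  "nbhd b x = insert x {y \<in> omega_limits. b \<sqsubset> y \<and> y \<sqsubset> x \<and> l x \<lhd> l y}"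

definition level_topology :: "'a topology" where
  "level_topology =
     topology (\<lambda>U. U \<subseteq> omega_limits \<and> (\<forall>x\<in>U. \<exists>b. b \<sqsubset> x \<and> nbhd b x \<subseteq> U))"

lemma nbhd_antimono:
  assumes "b \<sqsubset> c \<or> b = c" shows "nbhd c x \<subseteq> nbhd b x"
  using assms less_trans unfolding nbhd_def by blast

lemma openin_level_topology:
  "openin level_topology U \<longleftrightarrow>
     U \<subseteq> omega_limits \<and> (\<forall>x\<in>U. \<exists>b. b \<sqsubset> x \<and> nbhd b x \<subseteq> U)"
proof -
  let ?O = "\<lambda>U. U \<subseteq> omega_limits \<and> (\<forall>x\<in>U. \<exists>b. b \<sqsubset> x \<and> nbhd b x \<subseteq> U)"
  have "?O (U \<inter> V)" if U: "?O U" and V: "?O V" for U V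
  proof (intro conjI ballI)
    fix x assume x: "x \<in> U \<inter> V"
    obtain b where b: "b \<sqsubset> x" "nbhd b x \<subseteq> U" using U x by blast
    obtain c where c: "c \<sqsubset> x" "nbhd c x \<subseteq> V" using V x by blast
    have "b \<sqsubset> c \<or> b = c \<or> c \<sqsubset> b" using less_linear b c prec_Field[of _ \<kappa> x] by blast
    then show "\<exists>d. d \<sqsubset> x \<and> nbhd d x \<subseteq> U \<inter> V"
      using b c nbhd_antimono[of b c x] nbhd_antimono[of c b x] by blast
  qed (use U in blast)
  moreover have "?O (\<Union>\<U>)" if "\<forall>U\<in>\<U>. ?O U" for \<U>
    using that by (meson Union_iff Union_least Union_upper order_trans)
  ultimately have "istopology ?O" unfolding istopology_def by blast
  then show ?thesis unfolding level_topology_def by (simp add: topology_inverse')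
qed

lemma omega_limit_less: "x \<in> omega_limits \<Longrightarrow> \<exists>b. b \<sqsubset> x"
  unfolding omega_limits_def ladder_def by blast

lemma topspace_level_topology: "topspace level_topology = omega_limits"
proof
  have "nbhd b x \<subseteq> omega_limits" if "x \<in> omega_limits" for b x using that by (auto simp: nbhd_def)
  then have "openin level_topology omega_limits"
    unfolding openin_level_topology using omega_limit_less by blast
  then show "omega_limits \<subseteq> topspace level_topology" by (rule openin_subset)
  show "topspace level_topology \<subseteq> omega_limits"
    using openin_topspace[of level_topology] unfolding openin_level_topology by blast
qed

text \<open>The points \<open>y \<noteq> x\<close> of \<open>nbhd b x\<close> have higher level than \<open>x\<close>, so \<open>nbhd b y \<subseteq> nbhd b x\<close>.\<close>
lemma openin_nbhd:
  assumes "x \<in> omega_limits" "b \<sqsubset> x"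
  shows "openin level_topology (nbhd b x)"
  unfolding openin_level_topology
proof (intro conjI ballI)
  fix y assume y: "y \<in> nbhd b x"
  then have "b \<sqsubset> y" using assms(2) unfolding nbhd_def by blast
  moreover have "nbhd b y \<subseteq> nbhd b x"
    using y less_trans[of _ y x] prec_trans[OF wo_levels, of "l x" "l y"] unfolding nbhd_def by blast
  ultimately show "\<exists>c. c \<sqsubset> y \<and> nbhd c y \<subseteq> nbhd b x" by blast
qed (use assms in \<open>auto simp: nbhd_def\<close>)

lemma first_countable_level_topology: "first_countable level_topology"
  unfolding first_countable_def topspace_level_topology
proof
  fix x assume x: "x \<in> omega_limits"
  then obtain c where c: "ladder x c" unfolding omega_limits_def by blast
  have "openin level_topology (nbhd (c n) x)" for n
    using openin_nbhd[OF x] c unfolding ladder_def by blast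
  moreover have "\<exists>n. nbhd (c n) x \<subseteq> U" if U: "openin level_topology U" "x \<in> U" for U
  proof -
    obtain b where b: "b \<sqsubset> x" "nbhd b x \<subseteq> U" using U unfolding openin_level_topology by blast
    obtain n where "b \<sqsubset> c n" using b(1) c unfolding ladder_def by blast
    then show ?thesis using b(2) nbhd_antimono[of b "c n" x] by blast
  qed
  moreover have "x \<in> nbhd b x" for b by (simp add: nbhd_def)
  ultimately show "\<exists>\<B>. countable \<B> \<and> (\<forall>V\<in>\<B>. openin level_topology V) \<and>
      (\<forall>U. openin level_topology U \<and> x \<in> U \<longrightarrow> (\<exists>V\<in>\<B>. x \<in> V \<and> V \<subseteq> U))"
    by (intro exI[of _ "range (\<lambda>n. nbhd (c n) x)"]) auto
qed

lemma Hausdorff_level_topology: "Hausdorff_space level_topology"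
proof -
  have *: "\<exists>U V. openin level_topology U \<and> openin level_topology V \<and> x \<in> U \<and> y \<in> V \<and> disjnt U V"
    if xy: "x \<in> omega_limits" "y \<in> omega_limits" "x \<sqsubset> y" for x y
  proof -
    obtain b where b: "b \<sqsubset> x" using omega_limit_less xy by blast
    have "z \<notin> nbhd x y" if "z \<in> nbhd b x" for z
      using that xy(3) less_asym[of z x] less_asym[of x y] unfolding nbhd_def by auto
    then have "disjnt (nbhd b x) (nbhd x y)" unfolding disjnt_iff by blast
    moreover have "x \<in> nbhd b x" "y \<in> nbhd x y" by (auto simp: nbhd_def)
    ultimately show ?thesis using openin_nbhd xy b by meson
  qed
  show ?thesis
    unfolding Hausdorff_space_def topspace_level_topology
  proof (intro allI impI, elim conjE)
    fix x y assume xy: "x \<in> omega_limits" "y \<in> omega_limits" "x \<noteq> y"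
    then have "x \<sqsubset> y \<or> y \<sqsubset> x" using less_linear omega_limits_Field by blast
    then show "\<exists>U V. openin level_topology U \<and> openin level_topology V \<and> x \<in> U \<and> y \<in> V \<and> disjnt U V"
      using *[of x y] *[of y x] xy disjnt_sym by metis
  qed
qed

text \<open>The \<open>\<kappa>\<close>-least point of a set is isolated in it, as neighbourhoods extend only downwards.\<close>
lemma scattered_level_topology: "scattered_space level_topology"
  unfolding scattered_space_def topspace_level_topology
proof (intro allI impI, elim conjE)
  fix S assume S: "S \<subseteq> omega_limits" "S \<noteq> {}"
  then obtain z where "z \<in> S" by blast
  then obtain x where x: "x \<in> S" "\<And>y. y \<in> S \<Longrightarrow> y = x \<or> x \<sqsubset> y"
    using prec_least[OF wo, of z S] S(1) omega_limits_Field by (metis subset_trans)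
  obtain b where b: "b \<sqsubset> x" using omega_limit_less x S by blast
  have "S \<inter> nbhd b x = {x}"
    using x less_asym unfolding nbhd_def by blast
  then have "openin (subtopology level_topology S) {x}"
    using openin_subtopology_Int2[OF openin_nbhd[OF _ b], of S] x(1) S(1) by auto
  then show "\<exists>x\<in>S. openin (subtopology level_topology S) {x}" using x by blast
qed

section \<open>A left-separating order of type at most the product\<close>

definition level_order :: "'a rel" where
  "level_order = {(x, y). x \<in> omega_limits \<and> y \<in> omega_limits \<and> ((x, l x), (y, l y)) \<in> \<kappa> \<cdot>o \<alpha>}"

lemmas wo_prod = Well_order_ordinal_prod[OF wo wo_levels]
lemmas Field_prod = Field_ordinal_prod[OF wo wo_levels]

lemma well_order_on_level_order: "well_order_on omega_limits level_order"
  unfolding level_order_def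
  by (rule well_order_on_pullback[OF wo_prod, where f = "\<lambda>x. (x, l x)"])
    (use Field_prod level omega_limits_Field in \<open>auto simp: inj_on_def\<close>)

lemma level_order_ordLeq: "level_order \<le>o \<kappa> \<cdot>o \<alpha>"
proof (rule strictly_monotone_imp_ordLeq[where f = "\<lambda>x. (x, l x)"])
  show "Well_order level_order"
    using well_order_on_level_order well_order_on_Well_order by metis
  show "(x, l x) \<prec>\<^bsub>\<kappa> \<cdot>o \<alpha>\<^esub> (y, l y)" if "x \<prec>\<^bsub>level_order\<^esub> y" for x y
    using that by (auto simp: prec_def level_order_def)
  show "(x, l x) \<in> Field (\<kappa> \<cdot>o \<alpha>)" if "x \<in> Field level_order" for x
    using that omega_limits_Field level Field_prod by (auto simp: Field_def level_order_def)
qed (rule wo_prod)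

lemma left_separating_level_order: "left_separating level_topology level_order"
  unfolding left_separating_def topspace_level_topology
proof (intro conjI ballI well_order_on_level_order)
  fix y assume y: "y \<in> omega_limits"
  let ?I = "{x \<in> omega_limits. (x, y) \<in> level_order \<and> x \<noteq> y}"
  have I: "z \<in> ?I \<longleftrightarrow> z \<in> omega_limits \<and> (z, l z) \<prec>\<^bsub>\<kappa> \<cdot>o \<alpha>\<^esub> (y, l y)" for z
    using y by (auto simp: level_order_def prec_def)
  have "z \<notin> ?I" if x: "x \<in> omega_limits - ?I" and z: "z \<in> nbhd b x" for x z b
  proof (cases "z = x")
    case False
    have "(x, l x) \<prec>\<^bsub>\<kappa> \<cdot>o \<alpha>\<^esub> (z, l z)"
      using z False x omega_limits_Field unfolding nbhd_def prec_ordinal_prod[OF wo] by blast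
    then show ?thesis using prec_trans[OF wo_prod] I x by blast
  qed (use x in blast)
  then have "nbhd b x \<subseteq> omega_limits - ?I" if "x \<in> omega_limits - ?I" for b x
    using that unfolding nbhd_def by blast
  then have "openin level_topology (omega_limits - ?I)"
    unfolding openin_level_topology using omega_limit_less by blast
  then show "closedin level_topology ?I" unfolding closedin_def topspace_level_topology by blast
qed

end

section \<open>The lower bound for all left-separating orders\<close>

definition (in uncountable_regular_cardinal) approaches ::
    "'b rel \<Rightarrow> ('a \<Rightarrow> 'b) \<Rightarrow> 'b \<Rightarrow> bool" where
  "approaches \<alpha> g u \<longleftrightarrow> (\<forall>d\<in>Field \<kappa>. g d \<prec>\<^bsub>\<alpha>\<^esub> u) \<and>
     (\<forall>v. v \<prec>\<^bsub>\<alpha>\<^esub> u \<longrightarrow> \<not> cofinal {d \<in> Field \<kappa>. g d \<prec>\<^bsub>\<alpha>\<^esub> v} \<kappa>)"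

text \<open>
  Cofinal fibres, even stationary ones, do not force every left-separating order to be long. If
  \<open>u\<close> has cofinality \<open>\<kappa>\<close>, it can happen that the points of level \<open>u\<close> may be distributed one by one
  over \<open>\<kappa>\<close> blocks cofinal below \<open>u\<close>, and the block \<open>u\<close> is lost: for \<open>u = \<kappa>\<close>, if every point \<open>d\<close> of
  another level has \<open>l d < d\<close>, put the points \<open>d\<close> of level \<open>\<kappa>\<close> into block \<open>d\<close>. The second assumption
  forbids this: on a stationary set the levels climb to \<open>u\<close>, and almost all points of that set are
  limits of points of level \<open>u\<close>.
\<close>

locale rich_level_function = level_function +
  assumes fibre_cofinal: "u \<in> Field \<alpha> \<Longrightarrow> cofinal {d \<in> omega_limits. l d = u} \<kappa>"
    and diagonal: "approaches \<alpha> g u \<Longrightarrow>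
      \<exists>h. approaches \<alpha> h u \<and> stationary {d \<in> omega_limits. l d = h d}"
begin

text \<open>
  The functions \<open>a\<close> and \<open>b\<close> stand for the components of an embedding of a left-separating
  order into \<open>\<kappa> \<cdot>o \<alpha>\<close>: the position within a block and the block. By left-separation, \<open>x\<close>
  comes before all points of some neighbourhood of \<open>x\<close>, and this is all that \<open>sep\<close> retains.
\<close>

context
  fixes a :: "'a \<Rightarrow> 'a" and b :: "'a \<Rightarrow> 'b"
  assumes a: "\<And>x. x \<in> omega_limits \<Longrightarrow> a x \<in> Field \<kappa>"
    and ab: "\<And>x y. x \<in> omega_limits \<Longrightarrow> y \<in> omega_limits \<Longrightarrow> a x = a y \<Longrightarrow> b x = b y \<Longrightarrow> x = y"
    and sep: "\<And>x. x \<in> omega_limits \<Longrightarrow> \<exists>c. c \<sqsubset> x \<and> (\<forall>s\<in>omega_limits.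
      c \<sqsubset> s \<longrightarrow> s \<sqsubset> x \<longrightarrow> l x \<lhd> l s \<longrightarrow> b x \<lhd> b s \<or> b x = b s \<and> a x \<sqsubset> a s)"
begin

lemma few_in_proper_part_of_block: "\<not> cofinal {x \<in> omega_limits. b x = u \<and> a x \<sqsubset> m} \<kappa>" (is "\<not> cofinal ?X \<kappa>")
proof -
  have "a ` ?X \<subseteq> under \<kappa> m" by (auto simp: under_def prec_def)
  moreover have "inj_on a ?X" using ab by (auto simp: inj_on_def)
  ultimately have "|?X| \<le>o |under \<kappa> m|" using card_of_ordLeq by blast
  then have "|?X| <o \<kappa>" using small_segment ordLeq_ordLess_trans by blast
  then show ?thesis using small_not_cofinal omega_limits_Field by blast
qed

text \<open>
  The heart of the lower bound. A failure at \<open>u\<close> produces a function that approaches \<open>u\<close>, and the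
  stationary set on which the levels approach \<open>u\<close> then transfers the failure to a smaller \<open>b s\<close>.
\<close>
lemma few_early: "\<not> cofinal {x \<in> omega_limits. \<not> l x \<lhd> u \<and> b x \<lhd> u} \<kappa>"
proof (induction u rule: wf_induct_rule[OF prec_wf[OF wo_levels]])
  case (1 u)
  let ?S = "\<lambda>v. {x \<in> omega_limits. \<not> l x \<lhd> v \<and> b x \<lhd> v}"
  have IH: "\<not> cofinal (?S v) \<kappa>" if "v \<lhd> u" for v using 1 that by blast
  show ?case
  proof
    assume S: "cofinal (?S u) \<kappa>"
    then have "\<forall>d\<in>Field \<kappa>. \<exists>x. x \<in> ?S u \<and> d \<sqsubset> x" unfolding cofinal_iff by blast
    from bchoice[OF this] obtain x where x: "\<And>d. d \<in> Field \<kappa> \<Longrightarrow> x d \<in> ?S u \<and> d \<sqsubset> x d"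
      by blast
    \<comment> \<open>If \<open>b (x d) \<lhd> v\<close>, then \<open>x d\<close> is also an early point for \<open>v\<close>, and there are few of those.\<close>
    have "approaches \<alpha> (\<lambda>d. b (x d)) u"
      unfolding approaches_def
    proof (intro conjI ballI allI impI)
      fix v assume v: "v \<lhd> u"
      show "\<not> cofinal {d \<in> Field \<kappa>. b (x d) \<lhd> v} \<kappa>"
      proof
        assume c: "cofinal {d \<in> Field \<kappa>. b (x d) \<lhd> v} \<kappa>"
        have "cofinal (?S v) \<kappa>"
          unfolding cofinal_iff
        proof
          fix e assume "e \<in> Field \<kappa>"
          then obtain d where d: "d \<in> Field \<kappa>" "b (x d) \<lhd> v" "e \<sqsubset> d"
            using c unfolding cofinal_iff by blast
          have "x d \<in> ?S v" using x[OF d(1)] d(2) v prec_trans[OF wo_levels _ v] by blast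
          moreover have "e \<sqsubset> x d" using x[OF d(1)] d(3) less_trans by blast
          ultimately show "\<exists>s\<in>?S v. e \<sqsubset> s" by blast
        qed
        then show False using IH v by blast
      qed
    qed (use x in blast)
    then obtain h where h: "approaches \<alpha> h u" "stationary {d \<in> omega_limits. l d = h d}"
      using diagonal by blast
    let ?D = "{d \<in> omega_limits. l d = h d}"
    let ?R = "\<lambda>x s. b x \<lhd> b s \<or> b x = b s \<and> a x \<sqsubset> a s"
    have "\<exists>s\<in>?S u. stationary {d \<in> ?D. ?R d s}"
    proof (rule pressing_down_to_cofinal_set[OF h(2) S])
      fix d assume d: "d \<in> ?D"
      then have "l d \<lhd> u" using h(1) omega_limits_Field unfolding approaches_def by auto
      then have "l d \<lhd> l s" if "s \<in> ?S u" for s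
        using that prec_linear[OF wo_levels level level, of d s] prec_trans[OF wo_levels, of "l s" "l d" u]
        by auto
      then show "\<exists>c. c \<sqsubset> d \<and> (\<forall>s\<in>?S u. c \<sqsubset> s \<longrightarrow> s \<sqsubset> d \<longrightarrow> ?R d s)"
        using sep[of d] d by blast
    qed
    then obtain s where s: "s \<in> ?S u" and T: "stationary {d \<in> ?D. ?R d s}" by blast
    have v: "b s \<lhd> u" using s by blast
    \<comment> \<open>Three bounded sets cover the stationary set: block \<open>b s\<close> before \<open>s\<close>,
      levels below \<open>b s\<close>, and early points for \<open>b s\<close>.\<close>
    let ?X = "{x \<in> omega_limits. b x = b s \<and> a x \<sqsubset> a s}"
    let ?Y = "{d \<in> Field \<kappa>. h d \<lhd> b s}"
    have "cofinal (?X \<union> (?Y \<union> ?S (b s))) \<kappa>"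
      by (rule cofinal_mono[OF stationary_cofinal[OF T]]) (use omega_limits_Field in auto)
    moreover have "\<not> cofinal ?Y \<kappa>" using h(1) v unfolding approaches_def by blast
    ultimately show False
      using cofinal_UnD[OF wo] few_in_proper_part_of_block[of "b s" "a s"] IH[OF v] by blast
  qed
qed

end

text \<open>
  A shorter order would end inside some block \<open>u\<close>. Almost all of the \<open>\<kappa>\<close> points of level \<open>u\<close>
  are in block \<open>u\<close> or later, so they would have to fit into a proper initial segment of that block.
\<close>
lemma ordLeq_left_separating:
  assumes r: "left_separating level_topology r"
  shows "\<kappa> \<cdot>o \<alpha> \<le>o r"
proof (rule ccontr)
  assume neg: "\<not> \<kappa> \<cdot>o \<alpha> \<le>o r"
  have wor: "Well_order r" and Fr: "Field r = omega_limits"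
    using r well_order_on_Well_order unfolding left_separating_def topspace_level_topology by metis+
  have "r <o \<kappa> \<cdot>o \<alpha>" using neg wor wo_prod not_ordLeq_iff_ordLess by blast
  then obtain p f where p: "p \<in> Field (\<kappa> \<cdot>o \<alpha>)"
    and f: "iso r (Restr (\<kappa> \<cdot>o \<alpha>) (underS (\<kappa> \<cdot>o \<alpha>) p)) f"
    using ordLess_iff_ordIso_Restr[OF wo_prod wor] unfolding ordIso_def by auto
  obtain m u where mu: "p = (m, u)" by fastforce
  have u: "u \<in> Field \<alpha>" using p Field_prod mu by blast
  define a b where "a x = fst (f x)" and "b x = snd (f x)" for x
  have fx: "f x = (a x, b x)" for x by (simp add: a_def b_def)
  have inj: "inj_on f omega_limits" using iso_imp_inj_on[OF f] Fr by simp
  have below: "(a x, b x) \<prec>\<^bsub>\<kappa> \<cdot>o \<alpha>\<^esub> (m, u)" if "x \<in> omega_limits" for x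
  proof -
    have "f x \<in> Field (Restr (\<kappa> \<cdot>o \<alpha>) (underS (\<kappa> \<cdot>o \<alpha>) p))" using iso_Field[OF f] that Fr by blast
    then have "f x \<in> underS (\<kappa> \<cdot>o \<alpha>) p" by (auto simp: Field_def)
    then show ?thesis by (auto simp: underS_def prec_def mu fx)
  qed
  have mono: "(a x, b x) \<prec>\<^bsub>\<kappa> \<cdot>o \<alpha>\<^esub> (a y, b y)"
    if "x \<in> omega_limits" "y \<in> omega_limits" "(x, y) \<in> r" "x \<noteq> y" for x y
    using iso_forward[OF that(3) f] inj that unfolding prec_def fx inj_on_def by auto
  have A: "a x \<in> Field \<kappa>" if "x \<in> omega_limits" for x
    using below[OF that] unfolding prec_ordinal_prod[OF wo] by blast
  have AB: "x = y" if "x \<in> omega_limits" "y \<in> omega_limits" "a x = a y" "b x = b y" for x y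
    using inj that fx unfolding inj_on_def by metis
  have SEP: "\<exists>c. c \<sqsubset> x \<and> (\<forall>s\<in>omega_limits.
      c \<sqsubset> s \<longrightarrow> s \<sqsubset> x \<longrightarrow> l x \<lhd> l s \<longrightarrow> b x \<lhd> b s \<or> b x = b s \<and> a x \<sqsubset> a s)"
    if x: "x \<in> omega_limits" for x
  proof -
    let ?I = "{y \<in> omega_limits. (y, x) \<in> r \<and> y \<noteq> x}"
    have "openin level_topology (omega_limits - ?I)"
      using r x unfolding left_separating_def closedin_def topspace_level_topology by blast
    moreover have "x \<in> omega_limits - ?I" using x by blast
    ultimately obtain c where c: "c \<sqsubset> x" "nbhd c x \<subseteq> omega_limits - ?I"
      unfolding openin_level_topology by blast
    have "b x \<lhd> b s \<or> b x = b s \<and> a x \<sqsubset> a s"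
      if s: "s \<in> omega_limits" "c \<sqsubset> s" "s \<sqsubset> x" "l x \<lhd> l s" for s
    proof -
      have "s \<notin> ?I" using c(2) s unfolding nbhd_def by blast
      moreover have "s \<noteq> x" using s(3) by (auto simp: prec_def)
      ultimately have "(x, s) \<in> r"
        using prec_linear[OF wor, of x s] x s(1) Fr unfolding prec_def by blast
      then show ?thesis
        using mono[OF x s(1)] \<open>s \<noteq> x\<close> unfolding prec_ordinal_prod[OF wo] by blast
    qed
    then show ?thesis using c(1) by blast
  qed
  \<comment> \<open>The pair \<open>(m, u)\<close> bounds the order, so all points of level \<open>u\<close> are in \<open>?X\<close> or early.\<close>
  let ?E = "{x \<in> omega_limits. \<not> l x \<lhd> u \<and> b x \<lhd> u}"
  let ?X = "{x \<in> omega_limits. b x = u \<and> a x \<sqsubset> m}"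
  have "cofinal (?X \<union> ?E) \<kappa>"
  proof (rule cofinal_mono[OF fibre_cofinal[OF u]], rule subsetI)
    fix x assume "x \<in> {d \<in> omega_limits. l d = u}"
    moreover from this have "b x \<lhd> u \<or> b x = u \<and> a x \<sqsubset> m"
      using below[of x] unfolding prec_ordinal_prod[OF wo] by blast
    ultimately show "x \<in> ?X \<union> ?E" by (auto simp: prec_def)
  qed
  then show False
    using cofinal_UnD[OF wo] few_in_proper_part_of_block[OF A AB SEP] few_early[OF A AB SEP] by blast
qed

lemma ord_left_level_topology: "\<exists>r. ord_left level_topology = Some r \<and> r =o \<kappa> \<cdot>o \<alpha>"
proof -
  have "left_separated level_topology"
    using left_separating_level_order unfolding left_separated_def by blast
  then obtain r where r: "ord_left level_topology = Some r" unfolding ord_left_def by auto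
  have "r \<le>o \<kappa> \<cdot>o \<alpha>"
    using ord_left_SomeD(2)[OF r left_separating_level_order] level_order_ordLeq ordLeq_transitive
    by blast
  moreover have "\<kappa> \<cdot>o \<alpha> \<le>o r" using ordLeq_left_separating ord_left_SomeD(1)[OF r] by blast
  ultimately show ?thesis using r ordIso_iff_ordLeq by blast
qed

end

section \<open>Existence of the level function\<close>

lemma (in uncountable_regular_cardinal) ex_rich_level_function:
  fixes \<alpha> :: "'b rel"
  assumes wo: "Well_order \<alpha>" and ne: "Field \<alpha> \<noteq> {}" and small: "|Field \<alpha>| \<le>o \<kappa>"
  shows "\<exists>l. rich_level_function \<kappa> \<alpha> l"
proof -
  define G where "G u = (SOME g. approaches \<alpha> g u)" for u
  have G: "approaches \<alpha> (G u) u" if "approaches \<alpha> g u" for g u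
    using someI[of "\<lambda>g. approaches \<alpha> g u", OF that] unfolding G_def .
  \<comment> \<open>One stationary set for each constant level, and one for each level to be approached.\<close>
  have "|Field \<alpha> <+> Field \<alpha>| \<le>o \<kappa>"
    by (rule card_of_Plus_ordLeq_infinite_Field[OF infinite_Field small small card])
  moreover have "Field \<alpha> <+> Field \<alpha> \<noteq> {}" using ne by auto
  ultimately obtain p where p: "range p \<subseteq> Field \<alpha> <+> Field \<alpha>"
    "\<And>j. j \<in> Field \<alpha> <+> Field \<alpha> \<Longrightarrow> stationary {d \<in> omega_limits. p d = j}"
    using stationary_partition by metis
  \<comment> \<open>The value \<open>u0\<close> serves the \<open>u\<close> that nothing approaches, where \<open>G u\<close> is arbitrary.\<close>
  obtain u0 where u0: "u0 \<in> Field \<alpha>" using ne by blast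
  define l where "l d = (case p d of Inl u \<Rightarrow> u
    | Inr u \<Rightarrow> if G u d \<in> Field \<alpha> then G u d else u0)" for d
  have lF: "l d \<in> Field \<alpha>" for d
  proof -
    have "p d \<in> Field \<alpha> <+> Field \<alpha>" using p(1) by blast
    then show ?thesis using u0 by (auto simp: l_def split: sum.split)
  qed
  interpret level_function \<kappa> \<alpha> l by unfold_locales (rule wo, rule lF)
  have "rich_level_function \<kappa> \<alpha> l"
  proof unfold_locales
    fix u assume "u \<in> Field \<alpha>"
    then have "stationary {d \<in> omega_limits. p d = Inl u}" using p(2) by blast
    then have "stationary {d \<in> omega_limits. l d = u}"
      by (rule stationary_mono) (auto simp: l_def)
    then show "cofinal {d \<in> omega_limits. l d = u} \<kappa>" by (rule stationary_cofinal)
  next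
    fix g u assume "approaches \<alpha> g u"
    then have Gu: "approaches \<alpha> (G u) u" by (rule G)
    obtain k where "k \<in> Field \<kappa>" using infinite_Field by fastforce
    then have "u \<in> Field \<alpha>" using Gu prec_Field unfolding approaches_def by metis
    then have "stationary {d \<in> omega_limits. p d = Inr u}" using p(2) by blast
    moreover have "G u d \<in> Field \<alpha>" if "d \<in> omega_limits" for d
      using Gu that omega_limits_Field prec_Field[of "G u d"] unfolding approaches_def by blast
    ultimately have "stationary {d \<in> omega_limits. l d = G u d}"
      by (elim stationary_mono) (auto simp: l_def)
    then show "\<exists>h. approaches \<alpha> h u \<and> stationary {d \<in> omega_limits. l d = h d}" using Gu by blast
  qed
  then show ?thesis by blast
qed

theorem theorem1p1:
  fixes \<kappa> :: "'a rel" and \<alpha> :: "'b rel"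
  assumes "Card_order \<kappa>" and "natLeq <o \<kappa>" and "regularCard \<kappa>"
    and "\<alpha> <o cardSuc \<kappa>"
  shows "\<exists>Y :: 'a topology.
           first_countable Y \<and> scattered_space Y \<and> Hausdorff_space Y \<and>
           (\<exists>\<rho>. ord_left Y = Some \<rho> \<and> \<rho> =o \<kappa> \<cdot>o \<alpha>)"
proof -
  interpret uncountable_regular_cardinal \<kappa> by unfold_locales (fact assms)+
  have wo_alpha: "Well_order \<alpha>" using assms(4) unfolding ordLess_def by blast
  show ?thesis
  proof (cases "\<alpha> = {}")
    case True
    let ?Y = "discrete_topology {} :: 'a topology"
    have sep: "left_separating ?Y r \<longleftrightarrow> r = {}" for r
      unfolding left_separating_def using well_order_on_Field[of "{}" r]
      by (auto simp: Field_def)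
    then have "left_separated ?Y" unfolding left_separated_def by blast
    then obtain r where r: "ord_left ?Y = Some r" unfolding ord_left_def by simp
    then have ol: "ord_left ?Y = Some {}" using ord_left_SomeD(1)[OF r] sep by simp
    have "\<kappa> \<cdot>o \<alpha> = {}" using True by (simp add: ordinal_prod_def)
    then have "({} :: 'a rel) =o \<kappa> \<cdot>o \<alpha>"
      by (simp add: ordIso_def iso_iff2 bij_betw_def)
    moreover have "first_countable ?Y" "scattered_space ?Y" "Hausdorff_space ?Y"
      by (auto simp: first_countable_def scattered_space_def Hausdorff_space_def)
    ultimately show ?thesis using ol by blast
  next
    case False
    have "|Field \<alpha>| <o cardSuc \<kappa>"
      using card_of_least[of "Field \<alpha>" \<alpha>] wo_alpha assms(4) ordLeq_ordLess_trans by blast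
    then have "|Field \<alpha>| \<le>o \<kappa>" using cardSuc_ordLeq_ordLess[OF card card_of_Card_order] by blast
    moreover have "Field \<alpha> \<noteq> {}" using False by (auto simp: Field_def)
    ultimately obtain l where "rich_level_function \<kappa> \<alpha> l"
      using ex_rich_level_function[OF wo_alpha] by blast
    then interpret rich_level_function \<kappa> \<alpha> l .
    show ?thesis
      using first_countable_level_topology scattered_level_topology Hausdorff_level_topology
        ord_left_level_topology by blast
  qed
qed

end
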